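(* Let $n\ge 1$. The direction is an invariant of $(\mathsf R^n,\mathsf R)$-knots and of $(\mathsf L^n,\mathsf L)$-knots. That is: if $f,g$ are two equivalent $(\mathsf R^n,\mathsf R)$-knots, then $D(f)=D(g)$; and if $f,g$ are two equivalent $(\mathsf L^n,\mathsf L)$-knots, then $D(f)=D(g)$.
   Context: The (closed) long ray $\mathsf R$ is the set $W(\omega_1)\times[0,1)$, where $W(\omega_1)$ is the set of ordinals $<\omega_1$, with the lexicographic order and the order topology. The long line $\mathsf L$ is the union of two copies $\mathsf L_-,\mathsf L_+$ of $\mathsf R$ glued at $0=(0,0)$, with the order reversed on $\mathsf L_-$, so that $\mathsf L$ is totally ordered (with the order topology). $\pi_i$ denotes projection onto the $i$-th coordinate. Let $\mathsf R'=(\{-1\}\times[0,1))\sqcup\mathsf R$ with the order topology (every element of $\{-1\}\times[0,1)$ precedes every element of $\mathsf R$), so $\mathsf R\subset\mathsf R'$. A $(Y,X)$-knot is a (continuous) embedding $X\to Y$, i.e. a homeomorphism onto its image. An isotopy $\phi_t$ ($t\in[0,1]$) of a space $Y$ is a continuous map $Y\times[0,1]\to Y$, $(y,t)\mapsto\phi_t(y)$, with every $\phi_t$ a homeomorphism of $Y$. Two $(\mathsf L^n,\mathsf L)$-knots $f,g$ are equivalent if there is an isotopy $\phi_t$ of $\mathsf L^n$ with $\phi_0=\mathrm{id}$ and $\phi_1\circ f=g$. Two $(\mathsf R^n,\mathsf R)$-knots $f,g$ are equivalent if there is an isotopy $\phi_t$ of $(\mathsf R')^n$ with $\phi_0=\mathrm{id}$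 and $\phi_1\circ f=g$. Direction. For continuous $f:\mathsf R\to\mathsf R^n$, $D(f)=(\delta_1(f),\dots,\delta_n(f))^T$ with $\delta_i(f)=1$ if $\pi_i\circ f$ is cofinal (has unbounded image) and $\delta_i(f)=0$ if $\pi_i\circ f$ is bounded. For continuous $g:\mathsf R\to\mathsf L^n$, $\delta(g)=(\delta_1(g),\dots,\delta_n(g))^T$ with $\delta_i(g)=+1$ if $\pi_i\circ g$ is cofinal in $\mathsf L_+$, $-1$ if $\pi_i\circ g$ is cofinal in $\mathsf L_-$ (image unbounded in the direction of $\mathsf L_-$), $0$ if $\pi_i\circ g$ is bounded. For continuous $f:\mathsf L\to\mathsf L^n$, $D(f)$ is the $n\times2$ matrix $\left(\delta(f|_{\mathsf L_-})\ \ \delta(f|_{\mathsf L_+})\right)$, where $\mathsf L_\pm$ are identified with $\mathsf R$. *)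

theory Defs
  imports "HOL-Analysis.Analysis"
begin

section \<open>The ordinals below \<open>\<omega>\<^sub>1\<close>\<close>

text \<open>
  \<open>cardSuc natLeq\<close> is the successor cardinal of \<open>\<aleph>\<^sub>0\<close>, given as a well-order; its order type
  is \<open>\<omega>\<^sub>1\<close>. The two countability lemmas below, together with the class \<open>wellorder\<close>,
  characterise \<open>W(\<omega>\<^sub>1)\<close> up to order isomorphism.
\<close>

unbundle cardinal_syntax

lemma countable_iff_card_le_natLeq: "countable A \<longleftrightarrow> |A| \<le>o natLeq"
proof -
  have "countable A \<longleftrightarrow> |A| \<le>o |UNIV :: nat set|"
    unfolding countable_def card_of_ordLeq[symmetric] by auto
  also have "\<dots> \<longleftrightarrow> |A| \<le>o natLeq"
    using card_of_nat ordIso_symmetric ordLeq_ordIso_trans by blast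
  finally show ?thesis .
qed

lemma Card_order_omega1: "Card_order (cardSuc natLeq)"
  by (rule cardSuc_Card_order[OF natLeq_Card_order])

lemma Well_order_omega1: "Well_order (cardSuc natLeq)"
  using Card_order_omega1 card_order_on_well_order_on by blast

lemma uncountable_Field_omega1: "uncountable (Field (cardSuc natLeq))"
proof
  assume "countable (Field (cardSuc natLeq))"
  then have "|Field (cardSuc natLeq)| \<le>o natLeq"
    by (simp add: countable_iff_card_le_natLeq)
  then have "cardSuc natLeq \<le>o natLeq"
    using card_of_Field_ordIso[OF Card_order_omega1] ordIso_ordLeq_trans ordIso_symmetric by blast
  then show False
    using cardSuc_greater[OF natLeq_Card_order] not_ordLess_ordLeq by blast
qed

typedef omega1 = "Field (cardSuc natLeq)"
  using uncountable_Field_omega1 by (metis countable_empty ex_in_conv)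

instantiation omega1 :: wellorder
begin

definition less_eq_omega1 :: "omega1 \<Rightarrow> omega1 \<Rightarrow> bool" where
  "a \<le> b \<longleftrightarrow> (Rep_omega1 a, Rep_omega1 b) \<in> cardSuc natLeq"

definition less_omega1 :: "omega1 \<Rightarrow> omega1 \<Rightarrow> bool" where
  "a < b \<longleftrightarrow> a \<le> b \<and> \<not> b \<le> a" for a b :: omega1

instance
proof
  have lin: "Linear_order (cardSuc natLeq)"
    using Well_order_omega1 by (simp add: well_order_on_def)
  have wf: "wf (cardSuc natLeq - Id)"
    using Well_order_omega1 by (simp add: well_order_on_def)
  fix a b c :: omega1
  show "a < b \<longleftrightarrow> a \<le> b \<and> \<not> b \<le> a" by (fact less_omega1_def)
  show "a \<le> a"
    using lin Rep_omega1[of a]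
    by (auto simp: less_eq_omega1_def order_on_defs refl_on_def)
  show "a \<le> c" if "a \<le> b" "b \<le> c"
    using that lin by (auto simp: less_eq_omega1_def order_on_defs dest: transD)
  show anti: "x = y" if "x \<le> y" "y \<le> x" for x y :: omega1
    using that lin
    by (metis Rep_omega1_inject antisymD less_eq_omega1_def linear_order_on_def partial_order_on_def)
  have tot: "x \<le> y \<or> y \<le> x" for x y :: omega1
  proof (cases "x = y")
    case False
    then show ?thesis
      using lin Rep_omega1[of x] Rep_omega1[of y]
      by (auto simp: less_eq_omega1_def linear_order_on_def total_on_def Rep_omega1_inject)
  next
    case True
    then show ?thesis
      using lin Rep_omega1[of x]
      by (auto simp: less_eq_omega1_def order_on_defs refl_on_def)
  qed
  show "a \<le> b \<or> b \<le> a" by (fact tot)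
  show "P a" if step: "\<And>x. (\<And>y. y < x \<Longrightarrow> P y) \<Longrightarrow> P x" for P and a :: omega1
  proof -
    have "wf (inv_image (cardSuc natLeq - Id) Rep_omega1)"
      using wf by (rule wf_inv_image)
    then show "P a"
    proof (induction a rule: wf_induct_rule)
      case (less x)
      show ?case
      proof (rule step)
        fix y :: omega1 assume "y < x"
        then have "(y, x) \<in> inv_image (cardSuc natLeq - Id) Rep_omega1"
          by (auto simp: less_omega1_def less_eq_omega1_def)
        then show "P y" by (rule less.IH)
      qed
    qed
  qed
qed

end

lemma uncountable_omega1: "uncountable (UNIV :: omega1 set)"
  using uncountable_Field_omega1 countable_image[of UNIV Rep_omega1]
    type_definition.Rep_range[OF type_definition_omega1] by auto

lemma countable_lessThan_omega1: "countable {..<a::omega1}"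
proof -
  have "|underS (cardSuc natLeq) (Rep_omega1 a)| <o cardSuc natLeq"
    by (rule card_of_underS[OF Card_order_omega1 Rep_omega1])
  then have "|underS (cardSuc natLeq) (Rep_omega1 a)| \<le>o natLeq"
    by (simp add: cardSuc_ordLeq_ordLess natLeq_Card_order card_of_Card_order)
  then have "countable (underS (cardSuc natLeq) (Rep_omega1 a))"
    by (simp add: countable_iff_card_le_natLeq)
  moreover have "Rep_omega1 ` {..<a} \<subseteq> underS (cardSuc natLeq) (Rep_omega1 a)"
    by (auto simp: underS_def less_omega1_def less_eq_omega1_def)
  ultimately have "countable (Rep_omega1 ` {..<a})"
    by (rule countable_subset[rotated])
  then show ?thesis
    by (rule countable_image_inj_on) (auto simp: inj_on_def Rep_omega1_inject)
qed

unbundle no cardinal_syntax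


section \<open>The closed long ray\<close>

typedef half_open_unit = "{0..<1::real}"
  by (rule exI[of _ 0]) simp

instantiation half_open_unit :: "{linorder, zero}"
begin

definition less_eq_half_open_unit :: "half_open_unit \<Rightarrow> half_open_unit \<Rightarrow> bool" where
  "s \<le> t \<longleftrightarrow> Rep_half_open_unit s \<le> Rep_half_open_unit t"

definition less_half_open_unit :: "half_open_unit \<Rightarrow> half_open_unit \<Rightarrow> bool" where
  "s < t \<longleftrightarrow> Rep_half_open_unit s < Rep_half_open_unit t"

definition zero_half_open_unit :: half_open_unit where
  "0 = Abs_half_open_unit 0"

instance
  by standard
    (auto simp: less_eq_half_open_unit_def less_half_open_unit_def Rep_half_open_unit_inject)

end

text \<open>
  A datatype rather than the product type, which already carries the product topology.
\<close>

datatype long_ray = Long_Ray omega1 half_open_unit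

instantiation long_ray :: "{linorder, zero}"
begin

fun less_eq_long_ray :: "long_ray \<Rightarrow> long_ray \<Rightarrow> bool" where
  "Long_Ray a s \<le> Long_Ray b t \<longleftrightarrow> a < b \<or> a = b \<and> s \<le> t"

fun less_long_ray :: "long_ray \<Rightarrow> long_ray \<Rightarrow> bool" where
  "Long_Ray a s < Long_Ray b t \<longleftrightarrow> a < b \<or> a = b \<and> s < t"

definition zero_long_ray :: long_ray where
  "0 = Long_Ray (LEAST a. True) 0"

instance
proof
  fix x y z :: long_ray
  show "x < y \<longleftrightarrow> x \<le> y \<and> \<not> y \<le> x" by (cases x; cases y) auto
  show "x \<le> x" by (cases x) auto
  show "x \<le> z" if "x \<le> y" "y \<le> z" using that by (cases x; cases y; cases z) auto
  show "x = y" if "x \<le> y" "y \<le> x" using that by (cases x; cases y) auto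
  show "x \<le> y \<or> y \<le> x" by (cases x; cases y) auto
qed

end

instantiation long_ray :: linorder_topology
begin

definition open_long_ray :: "long_ray set \<Rightarrow> bool" where
  "open_long_ray = generate_topology (range (\<lambda>a. {..<a}) \<union> range (\<lambda>a. {a<..}))"

instance
  by standard (fact open_long_ray_def)

end

lemma zero_le_long_ray: "0 \<le> (x :: long_ray)"
proof (cases x)
  case (Long_Ray a s)
  have "(LEAST a::omega1. True) \<le> a"
    by (rule Least_le) simp
  moreover have "0 \<le> s"
    using Rep_half_open_unit[of s]
    by (simp add: less_eq_half_open_unit_def zero_half_open_unit_def Abs_half_open_unit_inverse)
  ultimately show ?thesis
    by (auto simp: Long_Ray zero_long_ray_def)
qed


section \<open>The extended long ray \<open>R'\<close>\<close>

text \<open>\<open>Collar t\<close> is the point \<open>(-1, t)\<close>, and \<open>Ray\<close> is the inclusion of \<open>R\<close> into \<open>R'\<close>.\<close>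

datatype ext_ray = Collar half_open_unit | Ray long_ray

instantiation ext_ray :: linorder
begin

fun less_eq_ext_ray :: "ext_ray \<Rightarrow> ext_ray \<Rightarrow> bool" where
  "Collar s \<le> Collar t \<longleftrightarrow> s \<le> t"
| "Collar s \<le> Ray y \<longleftrightarrow> True"
| "Ray x \<le> Collar t \<longleftrightarrow> False"
| "Ray x \<le> Ray y \<longleftrightarrow> x \<le> y"

definition less_ext_ray :: "ext_ray \<Rightarrow> ext_ray \<Rightarrow> bool" where
  "x < y \<longleftrightarrow> x \<le> y \<and> \<not> y \<le> x" for x y :: ext_ray

instance
proof
  fix x y z :: ext_ray
  show "x < y \<longleftrightarrow> x \<le> y \<and> \<not> y \<le> x" by (fact less_ext_ray_def)
  show "x \<le> x" by (cases x) auto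
  show "x \<le> z" if "x \<le> y" "y \<le> z" using that by (cases x; cases y; cases z) auto
  show "x = y" if "x \<le> y" "y \<le> x" using that by (cases x; cases y) auto
  show "x \<le> y \<or> y \<le> x" by (cases x; cases y) auto
qed

end

instantiation ext_ray :: linorder_topology
begin

definition open_ext_ray :: "ext_ray set \<Rightarrow> bool" where
  "open_ext_ray = generate_topology (range (\<lambda>a. {..<a}) \<union> range (\<lambda>a. {a<..}))"

instance
  by standard (fact open_ext_ray_def)

end


section \<open>The long line\<close>

text \<open>
  The left summand of \<open>long_ray + long_ray\<close> is the copy \<open>L\<^sub>-\<close>, the right summand the copy
  \<open>L\<^sub>+\<close>.
\<close>

fun glue :: "long_ray + long_ray \<Rightarrow> long_ray + long_ray \<Rightarrow> bool" where
  "glue (Inl x) (Inl y) \<longleftrightarrow> x = y"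
| "glue (Inr x) (Inr y) \<longleftrightarrow> x = y"
| "glue (Inl x) (Inr y) \<longleftrightarrow> x = 0 \<and> y = 0"
| "glue (Inr x) (Inl y) \<longleftrightarrow> x = 0 \<and> y = 0"

fun glue_le :: "long_ray + long_ray \<Rightarrow> long_ray + long_ray \<Rightarrow> bool" where
  "glue_le (Inl x) (Inl y) \<longleftrightarrow> y \<le> x"
| "glue_le (Inr x) (Inr y) \<longleftrightarrow> x \<le> y"
| "glue_le (Inl x) (Inr y) \<longleftrightarrow> True"
| "glue_le (Inr x) (Inl y) \<longleftrightarrow> x = 0 \<and> y = 0"

lemma glue_iff: "glue u v \<longleftrightarrow> glue_le u v \<and> glue_le v u"
  by (cases u; cases v) auto

lemma glue_le_refl: "glue_le u u"
  by (cases u) auto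

lemma glue_le_trans: "glue_le u v \<Longrightarrow> glue_le v w \<Longrightarrow> glue_le u w"
  using zero_le_long_ray by (cases u; cases v; cases w) (auto intro: order_trans order_antisym)

lemma glue_le_total: "glue_le u v \<or> glue_le v u"
  by (cases u; cases v) auto

quotient_type long_line = "long_ray + long_ray" / glue
  by (rule equivpI)
    (auto simp: reflp_def symp_def transp_def glue_iff intro: glue_le_refl glue_le_trans)

lift_definition neg_half :: "long_ray \<Rightarrow> long_line" is Inl .

lift_definition pos_half :: "long_ray \<Rightarrow> long_line" is Inr .

instantiation long_line :: linorder
begin

lift_definition less_eq_long_line :: "long_line \<Rightarrow> long_line \<Rightarrow> bool" is glue_le
  by (meson glue_iff glue_le_trans)

definition less_long_line :: "long_line \<Rightarrow> long_line \<Rightarrow> bool" where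
  "x < y \<longleftrightarrow> x \<le> y \<and> \<not> y \<le> x" for x y :: long_line

instance
proof
  fix x y z :: long_line
  show "x < y \<longleftrightarrow> x \<le> y \<and> \<not> y \<le> x" by (fact less_long_line_def)
  show "x \<le> x" by transfer (rule glue_le_refl)
  show "x \<le> y \<Longrightarrow> y \<le> z \<Longrightarrow> x \<le> z" by transfer (rule glue_le_trans)
  show "x \<le> y \<Longrightarrow> y \<le> x \<Longrightarrow> x = y" by transfer (simp add: glue_iff)
  show "x \<le> y \<or> y \<le> x" by transfer (rule glue_le_total)
qed

end

instantiation long_line :: linorder_topology
begin

definition open_long_line :: "long_line set \<Rightarrow> bool" where
  "open_long_line = generate_topology (range (\<lambda>a. {..<a}) \<union> range (\<lambda>a. {a<..}))"

instance
  by standard (fact open_long_line_def)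

end


section \<open>Knots, isotopies and equivalence\<close>

definition knot :: "('x::topological_space \<Rightarrow> 'y::topological_space) \<Rightarrow> bool" where
  "knot f \<longleftrightarrow> embedding_map euclidean euclidean f"

definition isotopy :: "(real \<Rightarrow> 'y::topological_space \<Rightarrow> 'y) \<Rightarrow> bool" where
  "isotopy \<phi> \<longleftrightarrow>
     continuous_on (UNIV \<times> {0..1}) (\<lambda>(y, t). \<phi> t y) \<and>
     (\<forall>t\<in>{0..1}. homeomorphic_map euclidean euclidean (\<phi> t))"

definition line_equivalent ::
    "(long_line \<Rightarrow> long_line ^ 'n) \<Rightarrow> (long_line \<Rightarrow> long_line ^ 'n) \<Rightarrow> bool" where
  "line_equivalent f g \<longleftrightarrow> (\<exists>\<phi>. isotopy \<phi> \<and> \<phi> 0 = id \<and> \<phi> 1 \<circ> f = g)"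

definition ray_incl :: "long_ray ^ 'n \<Rightarrow> ext_ray ^ 'n" where
  "ray_incl v = (\<chi> i. Ray (v $ i))"

definition ray_equivalent ::
    "(long_ray \<Rightarrow> long_ray ^ 'n) \<Rightarrow> (long_ray \<Rightarrow> long_ray ^ 'n) \<Rightarrow> bool" where
  "ray_equivalent f g \<longleftrightarrow>
     (\<exists>\<phi> :: real \<Rightarrow> ext_ray ^ 'n \<Rightarrow> ext_ray ^ 'n.
        isotopy \<phi> \<and> \<phi> 0 = id \<and> \<phi> 1 \<circ> (ray_incl \<circ> f) = ray_incl \<circ> g)"


section \<open>Directions\<close>

text \<open>Every subset of \<open>R\<close> is bounded below by \<open>0\<close>, so only \<open>bdd_above\<close> matters here.\<close>

definition ray_direction :: "(long_ray \<Rightarrow> long_ray ^ 'n) \<Rightarrow> int ^ 'n" where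
  "ray_direction f = (\<chi> i. if bdd_above (range (\<lambda>x. f x $ i)) then 0 else 1)"

text \<open>
  For continuous \<open>g\<close> a coordinate cannot be unbounded in both directions (two closed unbounded
  subsets of \<open>R\<close> meet), so the order of the two tests below is immaterial.
\<close>

definition half_direction :: "(long_ray \<Rightarrow> long_line ^ 'n) \<Rightarrow> int ^ 'n" where
  "half_direction g = (\<chi> i.
     if \<not> bdd_above (range (\<lambda>x. g x $ i)) then 1
     else if \<not> bdd_below (range (\<lambda>x. g x $ i)) then - 1
     else 0)"

text \<open>The \<open>n \<times> 2\<close> matrix with columns \<open>\<delta>(f|L\<^sub>-)\<close> and \<open>\<delta>(f|L\<^sub>+)\<close>.\<close>

definition line_direction :: "(long_line \<Rightarrow> long_line ^ 'n) \<Rightarrow> int ^ 2 ^ 'n" where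
  "line_direction f =
     (\<chi> i. vector [half_direction (f \<circ> neg_half) $ i, half_direction (f \<circ> pos_half) $ i])"

end

(*
  Along the isotopy, each coordinate of the knot, followed by a retraction of the target onto the
  long ray (for the long line, the positive or the negative part), is a homotopy h_t of maps from
  the long ray R to itself.  The set of t for which h_t is bounded is closed, because countable
  subsets of R are bounded.  Its complement is closed as well: if h_(t_n) is unbounded for all n,
  then each {x. y <= h_(t_n) x} is closed and unbounded, and countably many closed unbounded
  subsets of R have a common point.  Connectedness of [0,1] gives the claim.
*)

theory Submission
  imports Defs
begin

section \<open>Order completeness of the long ray\<close>

lemma half_open_unit_dense:
  fixes s t :: half_open_unit
  assumes "s < t"
  shows "\<exists>u. s < u \<and> u < t"
proof -
  let ?m = "(Rep_half_open_unit s + Rep_half_open_unit t) / 2"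
  have "?m \<in> {0..<1}"
    using Rep_half_open_unit[of s] Rep_half_open_unit[of t] by auto
  then have "s < Abs_half_open_unit ?m \<and> Abs_half_open_unit ?m < t"
    using assms by (simp add: less_half_open_unit_def Abs_half_open_unit_inverse)
  then show ?thesis by blast
qed

lemma half_open_unit_no_top: "\<exists>u. s < (u :: half_open_unit)"
proof -
  let ?m = "(Rep_half_open_unit s + 1) / 2"
  have "?m \<in> {0..<1}"
    using Rep_half_open_unit[of s] by auto
  then have "s < Abs_half_open_unit ?m"
    using Rep_half_open_unit[of s] by (simp add: less_half_open_unit_def Abs_half_open_unit_inverse)
  then show ?thesis by blast
qed

text \<open>The real infimum of the representatives is nonnegative and lies below an element of
  \<open>T\<close>, hence stays in the interval. Suprema would not do: they can equal the missing
  endpoint 1.\<close>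

lemma half_open_unit_glb:
  fixes T :: "half_open_unit set"
  assumes "T \<noteq> {}"
  shows "\<exists>i. (\<forall>t\<in>T. i \<le> t) \<and> (\<forall>j. (\<forall>t\<in>T. j \<le> t) \<longrightarrow> j \<le> i)"
proof -
  let ?I = "Inf (Rep_half_open_unit ` T)"
  have bdd: "bdd_below (Rep_half_open_unit ` T)"
    using Rep_half_open_unit by (auto intro!: bdd_belowI[of _ 0])
  obtain t where t: "t \<in> T"
    using assms by blast
  have "0 \<le> ?I"
    using assms Rep_half_open_unit by (auto intro!: cINF_greatest)
  moreover have le: "?I \<le> Rep_half_open_unit t" if "t \<in> T" for t
    using bdd that by (rule cINF_lower)
  then have "?I < 1"
    using le[OF t] Rep_half_open_unit[of t] by auto
  ultimately have rep: "Rep_half_open_unit (Abs_half_open_unit ?I) = ?I"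
    by (simp add: Abs_half_open_unit_inverse)
  show ?thesis
    using le assms
    by (intro exI[of _ "Abs_half_open_unit ?I"])
      (auto simp: less_eq_half_open_unit_def rep intro!: cINF_greatest)
qed

text \<open>Work with the upper bounds rather than with \<open>S\<close>: choose the least ordinal
  \<open>a\<close> whose block contains an upper bound, and in that block take the infimum of the
  second coordinates of upper bounds.\<close>

lemma long_ray_lub:
  fixes S :: "long_ray set"
  assumes "bdd_above S"
  shows "\<exists>u. (\<forall>x\<in>S. x \<le> u) \<and> (\<forall>v. (\<forall>x\<in>S. x \<le> v) \<longrightarrow> u \<le> v)"
proof -
  define ub where "ub a s \<longleftrightarrow> (\<forall>x\<in>S. x \<le> Long_Ray a s)" for a s
  define a where "a = (LEAST a. \<exists>s. ub a s)"
  obtain b where b: "\<forall>x\<in>S. x \<le> b"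
    using assms by (auto simp: bdd_above_def)
  have "\<exists>a s. ub a s"
    using b unfolding ub_def by (cases b) blast
  then have ex: "\<exists>s. ub a s"
    unfolding a_def by (rule LeastI_ex)
  have least: "a \<le> a'" if "ub a' s" for a' s
    unfolding a_def using that by (blast intro: Least_le)
  obtain i where i: "\<And>t. ub a t \<Longrightarrow> i \<le> t" "\<And>j. (\<And>t. ub a t \<Longrightarrow> j \<le> t) \<Longrightarrow> j \<le> i"
    using half_open_unit_glb[of "{t. ub a t}"] ex by auto
  have "x \<le> Long_Ray a i" if "x \<in> S" for x
  proof (cases x)
    case (Long_Ray c r)
    \<comment> \<open>If \<open>c = a\<close>, then \<open>r\<close> is a lower bound of the second
      coordinates whose infimum is \<open>i\<close>, which gives \<open>r \<le> i\<close>.\<close>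
    have "c < a \<or> c = a \<and> r \<le> t" if "ub a t" for t
      using that \<open>x \<in> S\<close> Long_Ray by (auto simp: ub_def dest!: bspec[of _ _ x])
    then show ?thesis
      using i(2) ex Long_Ray by auto
  qed
  moreover have "Long_Ray a i \<le> v" if "\<forall>x\<in>S. x \<le> v" for v
  proof (cases v)
    case (Long_Ray c t)
    then have "ub c t"
      using that by (simp add: ub_def)
    then show ?thesis
      using least[of c t] i(1) Long_Ray by (cases "a = c") auto
  qed
  ultimately show ?thesis by blast
qed

text \<open>The supremum of the set of lower bounds, which any element of \<open>S\<close> bounds
  above.\<close>

lemma long_ray_glb:
  fixes S :: "long_ray set"
  assumes "S \<noteq> {}"
  shows "\<exists>u. (\<forall>x\<in>S. u \<le> x) \<and> (\<forall>v. (\<forall>x\<in>S. v \<le> x) \<longrightarrow> v \<le> u)"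
proof -
  have "bdd_above {v. \<forall>x\<in>S. v \<le> x}"
    using assms by (auto simp: bdd_above_def)
  from long_ray_lub[OF this] show ?thesis
    by blast
qed

instantiation long_ray :: linear_continuum_topology
begin

definition sup_long_ray :: "long_ray \<Rightarrow> long_ray \<Rightarrow> long_ray" where "sup_long_ray = max"
definition inf_long_ray :: "long_ray \<Rightarrow> long_ray \<Rightarrow> long_ray" where "inf_long_ray = min"
text \<open>The value is arbitrary when no least upper bound exists; conditional completeness
  constrains only bounded sets.\<close>

definition Sup_long_ray :: "long_ray set \<Rightarrow> long_ray" where
  "Sup_long_ray S = (LEAST u. \<forall>x\<in>S. x \<le> u)"
definition Inf_long_ray :: "long_ray set \<Rightarrow> long_ray" where
  "Inf_long_ray S = (GREATEST u. \<forall>x\<in>S. u \<le> x)"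

instance
proof
  fix x y z :: long_ray and S :: "long_ray set"
  show "inf x y \<le> x" "inf x y \<le> y" "x \<le> y \<Longrightarrow> x \<le> z \<Longrightarrow> x \<le> inf y z"
    "x \<le> sup x y" "y \<le> sup x y" "y \<le> x \<Longrightarrow> z \<le> x \<Longrightarrow> sup y z \<le> x"
    by (auto simp: sup_long_ray_def inf_long_ray_def)
  have Inf: "(\<forall>x\<in>S. Inf S \<le> x) \<and> (\<forall>v. (\<forall>x\<in>S. v \<le> x) \<longrightarrow> v \<le> Inf S)"
    if ne: "S \<noteq> {}" for S :: "long_ray set"
  proof -
    obtain u where u: "\<forall>x\<in>S. u \<le> x" "\<forall>v. (\<forall>x\<in>S. v \<le> x) \<longrightarrow> v \<le> u"
      using long_ray_glb[OF ne] by blast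
    then have "Inf S = u"
      unfolding Inf_long_ray_def by (intro Greatest_equality) auto
    then show ?thesis using u by simp
  qed
  have Sup: "(\<forall>x\<in>S. x \<le> Sup S) \<and> (\<forall>v. (\<forall>x\<in>S. x \<le> v) \<longrightarrow> Sup S \<le> v)"
    if bdd: "bdd_above S" for S :: "long_ray set"
  proof -
    obtain u where u: "\<forall>x\<in>S. x \<le> u" "\<forall>v. (\<forall>x\<in>S. x \<le> v) \<longrightarrow> u \<le> v"
      using long_ray_lub[OF bdd] by blast
    then have "Sup S = u"
      unfolding Sup_long_ray_def by (intro Least_equality) auto
    then show ?thesis using u by simp
  qed
  show "x \<in> S \<Longrightarrow> bdd_below S \<Longrightarrow> Inf S \<le> x" using Inf[of S] by blast
  show "S \<noteq> {} \<Longrightarrow> (\<And>x. x \<in> S \<Longrightarrow> z \<le> x) \<Longrightarrow> z \<le> Inf S" using Inf[of S] by blast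
  show "x \<in> S \<Longrightarrow> bdd_above S \<Longrightarrow> x \<le> Sup S" using Sup[of S] by blast
  show "S \<noteq> {} \<Longrightarrow> (\<And>x. x \<in> S \<Longrightarrow> x \<le> z) \<Longrightarrow> Sup S \<le> z"
    using Sup[of S] by (auto simp: bdd_above_def)
  \<comment> \<open>Within one block this is density of the unit interval. Across blocks, a point
    further up in the block of \<open>x\<close> works, since that block has no greatest
    element.\<close>
  show "\<exists>z. x < z \<and> z < y" if "x < y"
  proof (cases x; cases y)
    fix a b s t assume xy: "x = Long_Ray a s" "y = Long_Ray b t"
    show ?thesis
    proof (cases "a = b")
      case True
      then show ?thesis
        using that xy half_open_unit_dense[of s t] by (metis less_irrefl less_long_ray.simps)
    next
      case False
      then show ?thesis
        using that xy half_open_unit_no_top[of s] by (metis less_long_ray.simps)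
    qed
  qed
  obtain a where "0 < (a :: half_open_unit)"
    using half_open_unit_no_top by blast
  then show "\<exists>a b :: long_ray. a \<noteq> b"
    by (metis less_irrefl long_ray.inject)
qed

end

section \<open>Countable subsets are bounded\<close>

lemma omega1_countable_bdd:
  fixes A :: "omega1 set"
  assumes "countable A"
  shows "\<exists>b. \<forall>a\<in>A. a < b"
proof (rule ccontr)
  assume "\<not> ?thesis"
  \<comment> \<open>Without a strict bound, countably many countable initial segments would cover
    the uncountable set of ordinals.\<close>
  then have "UNIV \<subseteq> (\<Union>a\<in>A. insert a {..<a})"
    by (force simp: not_less le_less)
  moreover have "countable (\<Union>a\<in>A. insert a {..<a})"
    using assms countable_lessThan_omega1 by auto
  ultimately show False
    using uncountable_omega1 countable_subset by blast
qed

text \<open>Bound the ordinal coordinates strictly by \<open>b\<close>; the first point of block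
  \<open>b\<close> is then above all of \<open>A\<close>.\<close>

lemma countable_bdd_above_long_ray:
  fixes A :: "long_ray set"
  assumes "countable A"
  shows "\<exists>b. \<forall>x\<in>A. x < b"
proof -
  let ?index = "\<lambda>x. case x of Long_Ray a s \<Rightarrow> a"
  obtain b where b: "\<forall>a\<in>?index ` A. a < b"
    using omega1_countable_bdd[OF countable_image[OF assms, of ?index]] by blast
  have "x < Long_Ray b 0" if "x \<in> A" for x
    using b that by (cases x) force
  then show ?thesis by blast
qed

lemma long_ray_no_top: "\<exists>y. (x :: long_ray) < y"
  using countable_bdd_above_long_ray[of "{x}"] by simp

section \<open>Closed unbounded sets\<close>

text \<open>A creeping argument in place of compactness of \<open>{..z}\<close>: at the supremum
  \<open>s\<close> of the points up to which \<open>h\<close> is bounded, local boundedness at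
  \<open>s\<close> extends the bound past \<open>s\<close>.\<close>

lemma bdd_above_image_atMost:
  fixes h :: "long_ray \<Rightarrow> long_ray"
  assumes h: "continuous_on UNIV h"
  shows "bdd_above (h ` {..z})"
proof (rule ccontr)
  assume z: "\<not> bdd_above (h ` {..z})"
  define S where "S = {x. bdd_above (h ` {..x})}"
  have S_z: "x < z" if "x \<in> S" for x
    using z bdd_above_mono[of "h ` {..x}" "h ` {..z}"] that
    by (force simp: S_def not_less)
  have "{..0} = {0 :: long_ray}"
    using zero_le_long_ray by (auto intro: antisym)
  then have "0 \<in> S"
    by (simp add: S_def)
  then have ne: "S \<noteq> {}"
    by blast
  have bdd: "bdd_above S"
    using S_z by (force intro: bdd_aboveI less_imp_le)
  define s where "s = Sup S"
  obtain c where c: "h s < c"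
    using long_ray_no_top by blast
  \<comment> \<open>A neighbourhood of \<open>s\<close> on which \<open>h\<close> is bounded by
    \<open>c\<close>.\<close>
  define U where "U = h -` {..<c}"
  have U: "open U" "s \<in> U"
    using h c by (auto simp: U_def open_vimage)
  obtain y where y: "s < y"
    using long_ray_no_top by blast
  obtain u where u: "s < u" "{s..<u} \<subseteq> U"
    using open_right[OF U y] by blast
  \<comment> \<open>The point \<open>u\<close> itself may lie outside \<open>U\<close>, so an
    intermediate \<open>v\<close> is taken; then \<open>{s..v}\<close> lies in
    \<open>U\<close>.\<close>
  obtain v where v: "s < v" "v < u"
    using dense[OF u(1)] by blast
  \<comment> \<open>If \<open>s\<close> is in \<open>S\<close>, the interval \<open>{x<..s}\<close>
    is empty for \<open>x = s\<close>; this includes \<open>s = 0\<close>, which has no left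
    neighbourhood. Otherwise elements of \<open>S\<close> approach \<open>s\<close> from
    below.\<close>
  obtain x where x: "x \<in> S" "{x<..s} \<subseteq> U"
  proof (cases "s \<in> S")
    case True
    then show ?thesis using that[of s] by simp
  next
    case False
    obtain x where x: "x \<in> S"
      using ne by blast
    then have "x < s"
      using False cSup_upper[OF x bdd] by (auto simp: s_def le_less)
    then obtain l where l: "l < s" "{l<..s} \<subseteq> U"
      using open_left[OF U] by blast
    obtain x' where "x' \<in> S" "l < x'"
      using l(1) less_cSup_iff[OF ne bdd] by (auto simp: s_def)
    then show ?thesis
      using that[of x'] l(2) by force
  qed
  have "h ` {..v} \<subseteq> h ` {..x} \<union> {..c}"
  proof
    fix w assume "w \<in> h ` {..v}"
    then obtain p where p: "p \<le> v" "w = h p" by auto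
    have "p \<in> U" if "x < p"
    proof (cases "p \<le> s")
      case True
      then show ?thesis using that x(2) by auto
    next
      case False
      then have "p \<in> {s..<u}" using p(1) v(2) by auto
      then show ?thesis using u(2) by blast
    qed
    then show "w \<in> h ` {..x} \<union> {..c}"
      using p by (cases "p \<le> x") (auto simp: U_def not_le intro: less_imp_le)
  qed
  then have "v \<in> S"
    using x(1) bdd_above_mono[of "h ` {..x} \<union> {..c}" "h ` {..v}"] by (simp add: S_def)
  then show False
    using v(1) cSup_upper[OF _ bdd] by (fastforce simp: s_def)
qed

text \<open>Initial segments have bounded image, so large values must recur beyond every
  \<open>z\<close>.\<close>

lemma unbounded_frequently_ge:
  fixes h :: "long_ray \<Rightarrow> long_ray"
  assumes "continuous_on UNIV h" "\<not> bdd_above (range h)"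
  shows "\<exists>x\<ge>z. y \<le> h x"
proof (rule ccontr)
  assume neg: "\<not> ?thesis"
  have "h x \<in> h ` {..z} \<union> {..y}" for x
    using neg by (cases "x \<le> z") (auto simp: not_le intro: less_imp_le)
  then have "range h \<subseteq> h ` {..z} \<union> {..y}"
    by blast
  moreover have "bdd_above (h ` {..z} \<union> {..y})"
    using bdd_above_image_atMost[OF assms(1)] by simp
  ultimately show False
    using assms(2) bdd_above_mono[of "h ` {..z} \<union> {..y}" "range h"] by simp
qed

lemma countable_closed_unbounded_Int:
  fixes C :: "nat \<Rightarrow> long_ray set"
  assumes closed: "\<And>n. closed (C n)" and unbdd: "\<And>n z. \<exists>x\<ge>z. x \<in> C n"
  shows "(\<Inter>n. C n) \<noteq> {}"
proof -
  \<comment> \<open>Below, each \<open>C n\<close> meets every \<open>[X k, X (Suc k)]\<close>, hence contains the limit of \<open>X\<close>.\<close>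
  define u where "u n z = (SOME x. z \<le> x \<and> x \<in> C n)" for n z
  have u: "z \<le> u n z \<and> u n z \<in> C n" for n z
    unfolding u_def using unbdd[of z n] by (rule someI_ex)
  \<comment> \<open>For fixed \<open>z\<close> the points \<open>u n z\<close> are countably many,
    so one map \<open>beyond\<close> serves all \<open>n\<close> at once.\<close>
  have "\<exists>b. \<forall>n. u n z < b" for z
    using countable_bdd_above_long_ray[of "range (\<lambda>n. u n z)"] by auto
  then obtain beyond where G: "\<And>n z. u n z < beyond z"
    by metis
  define X where "X k = (beyond ^^ k) 0" for k
  have between: "X k \<le> u n (X k)" "u n (X k) \<le> X (Suc k)" for n k
    using u[of "X k" n] G[of n "X k"] by (simp_all add: X_def less_imp_le)
  have "incseq X"
    using between order_trans by (blast intro: incseq_SucI)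
  \<comment> \<open>The range of a sequence is countable, hence bounded, so the increasing
    \<open>X\<close> converges to its supremum.\<close>
  moreover have "bdd_above (range X)"
    using countable_bdd_above_long_ray[of "range X"] by (force intro: bdd_aboveI less_imp_le)
  ultimately have lim: "X \<longlonglongrightarrow> (SUP k. X k)"
    by (intro LIMSEQ_incseq_SUP)
  have "(SUP k. X k) \<in> C n" for n
  proof (rule Lim_in_closed_set[OF closed])
    show "(\<lambda>k. u n (X k)) \<longlonglongrightarrow> (SUP k. X k)"
      by (rule tendsto_sandwich[OF _ _ lim LIMSEQ_Suc[OF lim]]) (use between in auto)
    show "\<forall>\<^sub>F k in sequentially. u n (X k) \<in> C n"
      using u by simp
  qed simp
  then show ?thesis by blast
qed

section \<open>Homotopies of the long ray\<close>

lemma homotopy_bdd_above_iff: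
  fixes h :: "long_ray \<Rightarrow> real \<Rightarrow> long_ray"
  assumes h: "continuous_on (UNIV \<times> {0..1}) (\<lambda>(x, t). h x t)"
  shows "bdd_above (range (\<lambda>x. h x 0)) \<longleftrightarrow> bdd_above (range (\<lambda>x. h x 1))"
proof -
  define B where "B = {t\<in>{0..1}. bdd_above (range (\<lambda>x. h x t))}"
  have cont_x: "continuous_on UNIV (\<lambda>x. h x t)" if "t \<in> {0..1}" for t
  proof -
    have "continuous_on UNIV (\<lambda>x :: long_ray. (x, t))"
      by (intro continuous_on_Pair continuous_on_id continuous_on_const)
    from continuous_on_compose2[OF h this] that show ?thesis
      by (simp add: image_subset_iff)
  qed
  have cont_t: "continuous_on {0..1} (h x)" for x
  proof -
    have "continuous_on {0..1} (\<lambda>t :: real. (x, t))"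
      by (intro continuous_on_Pair continuous_on_id continuous_on_const)
    from continuous_on_compose2[OF h this] show ?thesis
      by (simp add: image_subset_iff)
  qed
  have lim: "(\<lambda>n. h x (t n)) \<longlonglongrightarrow> h x l" if "\<And>n. t n \<in> {0..1}" "t \<longlonglongrightarrow> l" for x t l
    using that closed_sequentially[OF closed_real_atLeastAtMost, of t 0 1 l]
    by (intro continuous_on_tendsto_compose[OF cont_t that(2)]) auto
  \<comment> \<open>Sequences of times suffice for closedness in the reals; this is what lets
    countability arguments in the long ray apply.\<close>
  have "closed B"
    unfolding closed_sequential_limits
  proof (intro allI impI, elim conjE)
    fix t l assume t: "\<forall>n. t n \<in> B" and l: "t \<longlonglongrightarrow> l"
    then have t01: "t n \<in> {0..1}" for n
      by (simp add: B_def)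
    have "\<exists>b. \<forall>x. h x (t n) \<le> b" for n
      using t by (auto simp: B_def bdd_above_def)
    then obtain b where b: "\<And>x n. h x (t n) \<le> b n"
      by metis
    \<comment> \<open>A single bound, uniform in \<open>n\<close> and \<open>x\<close>, survives the
      limit taken for each fixed \<open>x\<close>.\<close>
    obtain c where c: "\<And>n. b n < c"
      using countable_bdd_above_long_ray[of "range b"] by auto
    have "h x (t n) \<le> c" for x n
      using b[of x n] c[of n] by (meson le_less_trans less_imp_le)
    then have "h x l \<le> c" for x
      by (intro LIMSEQ_le_const2[OF lim[OF t01 l]]) simp
    moreover have "l \<in> {0..1}"
      using closed_sequentially[OF closed_real_atLeastAtMost] t01 l by blast
    ultimately show "l \<in> B"
      by (auto simp: B_def bdd_above_def)
  qed
  moreover have "closed ({0..1} - B)"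
    unfolding closed_sequential_limits
  proof (intro allI impI, elim conjE)
    fix t l assume t: "\<forall>n. t n \<in> {0..1} - B" and l: "t \<longlonglongrightarrow> l"
    then have t01: "t n \<in> {0..1}" for n
      by blast
    have "\<exists>x. y \<le> h x l" for y
    proof -
      \<comment> \<open>One \<open>x\<close> must serve all \<open>n\<close>, because the passage to
        the limit in \<open>t\<close> is made at fixed \<open>x\<close>.\<close>
      have "(\<Inter>n. {x. y \<le> h x (t n)}) \<noteq> {}"
      proof (rule countable_closed_unbounded_Int)
        fix n z
        show "closed {x. y \<le> h x (t n)}"
          by (intro closed_Collect_le continuous_on_const cont_x t01)
        show "\<exists>x\<ge>z. x \<in> {x. y \<le> h x (t n)}"
          using unbounded_frequently_ge[OF cont_x[OF t01[of n]]] t by (auto simp: B_def)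
      qed
      then obtain x where "\<And>n. y \<le> h x (t n)"
        by blast
      then have "y \<le> h x l"
        by (intro LIMSEQ_le_const[OF lim[OF t01 l]]) simp
      then show ?thesis by blast
    qed
    then have "\<not> bdd_above (range (\<lambda>x. h x l))"
      using long_ray_no_top unfolding bdd_above_def by (metis leD order.trans rangeI)
    moreover have "l \<in> {0..1}"
      using closed_sequentially[OF closed_real_atLeastAtMost] t01 l by blast
    ultimately show "l \<in> {0..1} - B"
      by (simp add: B_def)
  qed
  moreover have "connected {0..1::real}"
    by simp
  moreover have "{0..1} \<subseteq> B \<union> ({0..1} - B)" "B \<inter> ({0..1} - B) \<inter> {0..1} = {}"
    by auto
  ultimately have "B \<inter> {0..1} = {} \<or> ({0..1} - B) \<inter> {0..1} = {}"
    unfolding connected_closed by blast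
  moreover have "0 \<in> {0..1::real}" "1 \<in> {0..1::real}"
    by simp_all
  ultimately have "0 \<in> B \<longleftrightarrow> 1 \<in> B"
    by blast
  then show ?thesis
    by (simp add: B_def)
qed

section \<open>Retractions onto the long ray\<close>

text \<open>Open rays form a subbasis of the order topology on the target.\<close>

lemma continuous_on_order_topologyI:
  fixes f :: "'a :: topological_space \<Rightarrow> 'b :: linorder_topology"
  assumes "\<And>a. open {x. f x < a}" "\<And>a. open {x. a < f x}"
  shows "continuous_on UNIV f"
  unfolding continuous_on_def
proof (intro ballI order_tendstoI)
  fix x a
  show "\<forall>\<^sub>F y in at x. a < f y" if "a < f x"
    using assms(2)[of a] that by (auto simp: eventually_at_topological)
  show "\<forall>\<^sub>F y in at x. f y < a" if "f x < a"
    using assms(1)[of a] that by (auto simp: eventually_at_topological)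
qed

section \<open>Inclusion into the extended ray and retraction back\<close>

lemma Ray_less_iff [simp]: "Ray x < Ray y \<longleftrightarrow> x < y"
  by (auto simp: less_ext_ray_def)

lemma Collar_less_Ray [simp]: "Collar s < Ray y" "\<not> Ray y < Collar s"
  by (auto simp: less_ext_ray_def)

lemma continuous_on_Ray: "continuous_on UNIV Ray"
proof (rule continuous_on_order_topologyI)
  fix a
  show "open {x. Ray x < a}"
    by (cases a) (simp_all add: open_lessThan[unfolded lessThan_def])
  show "open {x. a < Ray x}"
    by (cases a) (simp_all add: open_greaterThan[unfolded greaterThan_def])
qed

text \<open>At intermediate times an isotopy may push the knot into the collar; this map brings
  coordinates back to the long ray.\<close>

fun ext_ray_retract :: "ext_ray \<Rightarrow> long_ray" where
  "ext_ray_retract (Collar s) = 0"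
| "ext_ray_retract (Ray x) = x"

declare zero_le_long_ray [simp]

lemma long_ray_le_zero_iff [simp]: "x \<le> (0 :: long_ray) \<longleftrightarrow> x = 0"
  using zero_le_long_ray[of x] by (auto intro: order.antisym)

lemma not_less_zero_long_ray [simp]: "\<not> x < (0 :: long_ray)"
  by (simp add: not_less)

lemma zero_less_long_ray_iff [simp]: "0 < (x :: long_ray) \<longleftrightarrow> x \<noteq> 0"
  by (simp add: less_le)

lemma continuous_on_ext_ray_retract: "continuous_on UNIV ext_ray_retract"
proof (rule continuous_on_order_topologyI)
  fix a
  \<comment> \<open>The value \<open>a = 0\<close> is exceptional: collar points lie below
    \<open>Ray 0\<close>, yet retract to 0.\<close>
  have "ext_ray_retract x < a \<longleftrightarrow> a \<noteq> 0 \<and> x < Ray a" for x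
    by (cases x) auto
  then have "{x. ext_ray_retract x < a} = (if a = 0 then {} else {..<Ray a})"
    by auto
  then show "open {x. ext_ray_retract x < a}"
    by simp
  have "a < ext_ray_retract x \<longleftrightarrow> Ray a < x" for x
    by (cases x) simp_all
  then show "open {x. a < ext_ray_retract x}"
    by (simp add: open_greaterThan[unfolded greaterThan_def])
qed

section \<open>Positive and negative parts on the long line\<close>

lift_definition pos_part :: "long_line \<Rightarrow> long_ray"
  is "\<lambda>u. case u of Inl x \<Rightarrow> 0 | Inr x \<Rightarrow> x"
  by (auto elim: glue.elims)

lift_definition neg_part :: "long_line \<Rightarrow> long_ray"
  is "\<lambda>u. case u of Inl x \<Rightarrow> x | Inr x \<Rightarrow> 0"
  by (auto elim: glue.elims)

text \<open>The parts are the analogues of \<open>max x 0\<close> and \<open>max (- x) 0\<close>.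
  This is a Galois connection with \<open>pos_half\<close>; it yields both preimages of rays and
  transfer of bounds.\<close>

lemma pos_part_le_iff: "pos_part x \<le> a \<longleftrightarrow> x \<le> pos_half a"
  by transfer (auto simp: zero_le_long_ray split: sum.splits)

lemma neg_part_le_iff: "neg_part x \<le> a \<longleftrightarrow> neg_half a \<le> x"
  by transfer (auto simp: zero_le_long_ray split: sum.splits)

text \<open>The case \<open>a = 0\<close> is separate because the whole negative half is sent to
  0.\<close>

lemma le_pos_part_iff: "a \<le> pos_part x \<longleftrightarrow> a = 0 \<or> pos_half a \<le> x"
  by transfer (auto split: sum.splits)

lemma le_neg_part_iff: "a \<le> neg_part x \<longleftrightarrow> a = 0 \<or> x \<le> neg_half a"
  by transfer (auto split: sum.splits)

lemma continuous_on_pos_part: "continuous_on UNIV pos_part"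
proof (rule continuous_on_order_topologyI)
  fix a
  have "{x. pos_part x < a} = (if a = 0 then {} else {..<pos_half a})"
    by (auto simp: le_pos_part_iff simp flip: not_le)
  then show "open {x. pos_part x < a}"
    by simp
  have "{x. a < pos_part x} = {pos_half a<..}"
    by (auto simp: pos_part_le_iff simp flip: not_le)
  then show "open {x. a < pos_part x}"
    by simp
qed

lemma continuous_on_neg_part: "continuous_on UNIV neg_part"
proof (rule continuous_on_order_topologyI)
  fix a
  have "{x. neg_part x < a} = (if a = 0 then {} else {neg_half a<..})"
    by (auto simp: le_neg_part_iff simp flip: not_le)
  then show "open {x. neg_part x < a}"
    by simp
  have "{x. a < neg_part x} = {..<neg_half a}"
    by (auto simp: neg_part_le_iff simp flip: not_le)
  then show "open {x. a < neg_part x}"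
    by simp
qed

section \<open>Inclusions of the two halves\<close>

lemma half_le_iff [simp]:
  "pos_half x \<le> pos_half y \<longleftrightarrow> x \<le> y"
  "neg_half x \<le> neg_half y \<longleftrightarrow> y \<le> x"
  "neg_half x \<le> pos_half y"
  "pos_half x \<le> neg_half y \<longleftrightarrow> x = 0 \<and> y = 0"
  by (transfer; simp)+

lemma long_line_cases:
  obtains x where "c = pos_half x" | x where "c = neg_half x"
proof -
  have "(\<exists>x. c = pos_half x) \<or> (\<exists>x. c = neg_half x)"
  proof (transfer, goal_cases)
    case (1 c)
    then show ?case
      by (cases c) (auto intro: exI[of "glue _"])
  qed
  then show thesis
    using that by blast
qed

lemma continuous_on_pos_half: "continuous_on UNIV pos_half"
proof (rule continuous_on_order_topologyI)
  fix c
  \<comment> \<open>The case split on \<open>y = 0\<close> reflects the gluing: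
    \<open>neg_half 0\<close> is also \<open>pos_half 0\<close>, so the origin does not lie strictly
    above it.\<close>
  have "{x. pos_half x < pos_half y} = {..<y}" "{x. pos_half x < neg_half y} = {}"
    "{x. pos_half y < pos_half x} = {y<..}"
    "{x. neg_half y < pos_half x} = (if y = 0 then {0<..} else UNIV)" for y
    by (auto simp flip: not_le)
  then show "open {x. pos_half x < c}" "open {x. c < pos_half x}"
    by (cases c rule: long_line_cases; simp)+
qed

lemma continuous_on_neg_half: "continuous_on UNIV neg_half"
proof (rule continuous_on_order_topologyI)
  fix c
  have "{x. neg_half x < neg_half y} = {y<..}" "{x. pos_half y < neg_half x} = {}"
    "{x. neg_half y < neg_half x} = {..<y}"
    "{x. neg_half x < pos_half y} = (if y = 0 then {0<..} else UNIV)" for y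
    by (auto simp flip: not_le)
  then show "open {x. neg_half x < c}" "open {x. c < neg_half x}"
    by (cases c rule: long_line_cases; simp)+
qed

text \<open>Bounds pass through the Galois connection: \<open>pos_half\<close> carries a bound to
  the line, \<open>pos_part\<close> carries one back.\<close>

lemma bdd_above_pos_part_iff: "bdd_above (range (\<lambda>x. pos_part (g x))) \<longleftrightarrow> bdd_above (range g)"
proof
  assume "bdd_above (range (\<lambda>x. pos_part (g x)))"
  then show "bdd_above (range g)"
    by (auto simp: bdd_above_def pos_part_le_iff)
next
  assume "bdd_above (range g)"
  then obtain b where "\<And>x. g x \<le> b"
    by (auto simp: bdd_above_def)
  moreover have "b \<le> pos_half (pos_part b)"
    by (simp flip: pos_part_le_iff)
  ultimately have "pos_part (g x) \<le> pos_part b" for x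
    by (meson order.trans pos_part_le_iff)
  then show "bdd_above (range (\<lambda>x. pos_part (g x)))"
    by (auto simp: bdd_above_def)
qed

text \<open>The same argument with the order reversed, so lower bounds on the line correspond to
  upper bounds on the ray.\<close>

lemma bdd_above_neg_part_iff: "bdd_above (range (\<lambda>x. neg_part (g x))) \<longleftrightarrow> bdd_below (range g)"
proof
  assume "bdd_above (range (\<lambda>x. neg_part (g x)))"
  then show "bdd_below (range g)"
    by (auto simp: bdd_above_def bdd_below_def neg_part_le_iff)
next
  assume "bdd_below (range g)"
  then obtain b where "\<And>x. b \<le> g x"
    by (auto simp: bdd_below_def)
  moreover have "neg_half (neg_part b) \<le> b"
    by (simp flip: neg_part_le_iff)
  ultimately have "neg_part (g x) \<le> neg_part b" for x
    by (meson order.trans neg_part_le_iff)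
  then show "bdd_above (range (\<lambda>x. neg_part (g x)))"
    by (auto simp: bdd_above_def)
qed

section \<open>Invariance of the direction\<close>

lemma knot_continuous_on: "knot f \<Longrightarrow> continuous_on UNIV f"
  by (auto simp: knot_def embedding_map_def continuous_map_in_subtopology
      dest!: homeomorphic_imp_continuous_map)

text \<open>The map \<open>r\<close> is left open so that the collar retraction and both parts of
  the long line are covered at once.\<close>

lemma isotopy_bdd_above_iff:
  fixes \<phi> :: "real \<Rightarrow> ('y :: topological_space) ^ 'n \<Rightarrow> 'y ^ 'n" and r :: "'y \<Rightarrow> long_ray"
  assumes \<phi>: "isotopy \<phi>" and r: "continuous_on UNIV r"
    and f: "continuous_on UNIV (f :: long_ray \<Rightarrow> 'y ^ 'n)"
  shows "bdd_above (range (\<lambda>x. r (\<phi> 0 (f x) $ i))) \<longleftrightarrow> bdd_above (range (\<lambda>x. r (\<phi> 1 (f x) $ i)))"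
proof (rule homotopy_bdd_above_iff)
  have "continuous_on (UNIV \<times> {0..1}) (\<lambda>z. (f (fst z), snd z :: real))"
    by (intro continuous_on_Pair continuous_on_compose2[OF f] continuous_on_fst continuous_on_snd
        continuous_on_id) auto
  from continuous_on_compose2[OF conjunct1[OF \<phi>[unfolded isotopy_def]] this]
  have "continuous_on (UNIV \<times> {0..1}) (\<lambda>z. \<phi> (snd z) (f (fst z)))"
    by (simp add: image_subset_iff)
  then have "continuous_on (UNIV \<times> {0..1}) (\<lambda>z. \<phi> (snd z) (f (fst z)) $ i)"
    by (auto simp: continuous_on_def intro: tendsto_vec_nth)
  then show "continuous_on (UNIV \<times> {0..1}) (\<lambda>(x, t). r (\<phi> t (f x) $ i))"
    unfolding case_prod_beta by (rule continuous_on_compose2[OF r]) simp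
qed

lemma continuous_on_ray_incl: "continuous_on UNIV ray_incl"
  unfolding ray_incl_def continuous_on_def
  by (auto intro!: tendsto_vec_lambda continuous_on_tendsto_compose[OF continuous_on_Ray]
      tendsto_vec_nth)

lemma ray_direction_invariant:
  fixes f g :: "long_ray \<Rightarrow> long_ray ^ 'n"
  assumes "knot f" "ray_equivalent f g"
  shows "ray_direction f = ray_direction g"
proof -
  obtain \<phi> :: "real \<Rightarrow> ext_ray ^ 'n \<Rightarrow> ext_ray ^ 'n" where \<phi>: "isotopy \<phi>" "\<phi> 0 = id"
    and g: "\<phi> 1 \<circ> (ray_incl \<circ> f) = ray_incl \<circ> g"
    using assms(2) by (auto simp: ray_equivalent_def)
  have f: "continuous_on UNIV (\<lambda>x. ray_incl (f x))"
    using continuous_on_compose2[OF continuous_on_ray_incl knot_continuous_on[OF assms(1)]] by simp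
  have g': "\<phi> 1 (ray_incl (f x)) = ray_incl (g x)" for x
    using fun_cong[OF g, of x] by simp
  have retract: "ext_ray_retract (ray_incl v $ i) = v $ i" for v :: "long_ray ^ 'n" and i
    by (simp add: ray_incl_def)
  \<comment> \<open>The retraction undoes \<open>ray_incl\<close>, so times 0 and 1 give exactly the
    coordinates of \<open>f\<close> and \<open>g\<close>.\<close>
  have "bdd_above (range (\<lambda>x. f x $ i)) \<longleftrightarrow> bdd_above (range (\<lambda>x. g x $ i))" for i
    using isotopy_bdd_above_iff[OF \<phi>(1) continuous_on_ext_ray_retract f, of i]
    by (simp add: \<phi>(2) g' retract)
  then show ?thesis
    by (simp add: ray_direction_def)
qed

text \<open>The two boundedness tests in \<open>half_direction\<close> are those of the positive and
  the negative part, each preserved by the isotopy.\<close>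

lemma half_direction_invariant:
  fixes f :: "long_ray \<Rightarrow> long_line ^ 'n"
  assumes \<phi>: "isotopy \<phi>" "\<phi> 0 = id" and f: "continuous_on UNIV f"
  shows "half_direction (\<phi> 1 \<circ> f) = half_direction f"
  using isotopy_bdd_above_iff[OF \<phi>(1) continuous_on_pos_part f]
    isotopy_bdd_above_iff[OF \<phi>(1) continuous_on_neg_part f]
  by (simp add: half_direction_def comp_def \<phi>(2) bdd_above_pos_part_iff bdd_above_neg_part_iff
      cong: if_cong)

lemma line_direction_invariant:
  fixes f g :: "long_line \<Rightarrow> long_line ^ 'n"
  assumes "knot f" "line_equivalent f g"
  shows "line_direction f = line_direction g"
proof -
  obtain \<phi> where \<phi>: "isotopy \<phi>" "\<phi> 0 = id" and g: "g = \<phi> 1 \<circ> f"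
    using assms(2) by (auto simp: line_equivalent_def)
  \<comment> \<open>Taking \<open>e\<close> to be \<open>neg_half\<close> and
    \<open>pos_half\<close> gives the two columns of the direction matrix.\<close>
  have "half_direction (g \<circ> e) = half_direction (f \<circ> e)" if "continuous_on UNIV e" for e
    using half_direction_invariant[OF \<phi>, of "f \<circ> e"] that knot_continuous_on[OF assms(1)]
    by (simp add: g comp_assoc continuous_on_compose2 comp_def)
  then show ?thesis
    by (simp add: line_direction_def continuous_on_pos_half continuous_on_neg_half)
qed

theorem theorem3p2:
  shows "(\<forall>f g :: long_ray \<Rightarrow> long_ray ^ 'n.
            knot f \<longrightarrow> knot g \<longrightarrow> ray_equivalent f g \<longrightarrow> ray_direction f = ray_direction g)
       \<and> (\<forall>f g :: long_line \<Rightarrow> long_line ^ 'n.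
            knot f \<longrightarrow> knot g \<longrightarrow> line_equivalent f g \<longrightarrow> line_direction f = line_direction g)"
  using ray_direction_invariant line_direction_invariant by blast

end
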